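(* For every $n$ and every $\alpha=\alpha(n)\ge1$ there exists an $n$-node directed weighted graph $G$ such that for every $\alpha$-approximate hopset $H$ of $G$ of size $|H|=O(n)$, the graph $G\cup H$ has $\alpha$-approximate hopbound $\Omega(n^{1/2})$. (Precisely: for every constant $C>0$ the graph can be chosen so that every $\alpha$-approximate hopset of size at most $Cn$ leaves hopbound at least $c\,n^{1/2}$, where $c>0$ depends only on $C$.)
   Context: Given a directed weighted graph $G$, an $\alpha$-approximate hopset is a set $H$ of additional edges $(u,v)$ with $v$ reachable from $u$, each given weight $w(u,v)=\mathrm{dist}_G(u,v)$. The $\alpha$-approximate hopbound of $G\cup H$ is the least $\beta$ such that for every pair $(s,t)$ with $t$ reachable from $s$ in $G$, there is an $s\leadsto t$ path in $G\cup H$ with at most $\beta$ edges and weight at most $\alpha\cdot\mathrm{dist}_G(s,t)$. *)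

theory Defs
  imports "Graph_Theory.Graph_Theory"
begin

text \<open>
  \<open>wf_digraph.\<mu> G w s t\<close> is the infimum of the costs of all walks from \<open>s\<close> to \<open>t\<close>, i.e. the
  distance. It is finite on reachable pairs when the weights are nonnegative.
\<close>

definition hopset :: "('a, 'b) pre_digraph \<Rightarrow> ('a \<times> 'a) set \<Rightarrow> bool" where
  "hopset G H \<longleftrightarrow> (\<forall>(u, v) \<in> H. u \<rightarrow>\<^sup>*\<^bsub>G\<^esub> v)"

text \<open>
  The arcs of \<open>H\<close> are kept apart from those of \<open>G\<close> by tagging, so that a hopset arc may be parallel
  to an arc of \<open>G\<close> of larger weight.
\<close>

definition hop_union :: "('a, 'b) pre_digraph \<Rightarrow> ('a \<times> 'a) set \<Rightarrow> ('a, 'b + 'a \<times> 'a) pre_digraph" where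
  "hop_union G H =
     \<lparr>verts = verts G, arcs = arcs G <+> H, tail = case_sum (tail G) fst, head = case_sum (head G) snd\<rparr>"

definition hop_weight :: "('a, 'b) pre_digraph \<Rightarrow> ('b \<Rightarrow> real) \<Rightarrow> 'b + 'a \<times> 'a \<Rightarrow> real" where
  "hop_weight G w = case_sum w (\<lambda>(u, v). real_of_ereal (wf_digraph.\<mu> G w u v))"

definition within_hops ::
  "real \<Rightarrow> ('a, 'b) pre_digraph \<Rightarrow> ('b \<Rightarrow> real) \<Rightarrow> ('a \<times> 'a) set \<Rightarrow> nat \<Rightarrow> bool" where
  "within_hops \<alpha> G w H \<beta> \<longleftrightarrow>
     (\<forall>s t. s \<rightarrow>\<^sup>*\<^bsub>G\<^esub> t \<longrightarrow>
        (\<exists>p. pre_digraph.apath (hop_union G H) s p t \<and> length p \<le> \<beta> \<and>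
             ereal (wf_digraph.awalk_cost (hop_weight G w) p) \<le> ereal \<alpha> * wf_digraph.\<mu> G w s t))"

definition hopbound ::
  "real \<Rightarrow> ('a, 'b) pre_digraph \<Rightarrow> ('b \<Rightarrow> real) \<Rightarrow> ('a \<times> 'a) set \<Rightarrow> nat" where
  "hopbound \<alpha> G w H = (LEAST \<beta>. within_hops \<alpha> G w H \<beta>)"


text \<open>The defining set of \<open>hopbound\<close> is inhabited, so \<open>LEAST\<close> really denotes a minimum.\<close>

lemma wf_hop_union:
  assumes "wf_digraph G" "hopset G H"
  shows "wf_digraph (hop_union G H)"
proof -
  interpret wf_digraph G by fact
  have "u \<in> verts G \<and> v \<in> verts G" if "(u, v) \<in> H" for u v
    using that assms(2) reachable_in_verts[of u v] unfolding hopset_def by blast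
  then show ?thesis
    by unfold_locales (auto simp: hop_union_def)
qed

lemma apath_hop_union:
  assumes "pre_digraph.apath G s p t"
  shows "pre_digraph.apath (hop_union G H) s (map Inl p) t"
proof -
  have cas: "pre_digraph.cas (hop_union G H) u (map Inl p) v = pre_digraph.cas G u p v" for u v
    by (induct p arbitrary: u) (simp_all add: pre_digraph.cas.simps hop_union_def)
  have av: "pre_digraph.awalk_verts (hop_union G H) u (map Inl p) = pre_digraph.awalk_verts G u p" for u
    by (induct p arbitrary: u) (simp_all add: pre_digraph.awalk_verts.simps hop_union_def)
  show ?thesis
    using assms unfolding pre_digraph.apath_def pre_digraph.awalk_def cas av
    by (auto simp: hop_union_def)
qed

lemma within_hops_hopbound:
  assumes "fin_digraph G" and nonneg: "\<And>e. e \<in> arcs G \<Longrightarrow> 0 \<le> w e" and "\<alpha> \<ge> 1"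
    and "hopset G H"
  shows "within_hops \<alpha> G w H (hopbound \<alpha> G w H)"
proof -
  interpret fin_digraph G by fact
  interpret U: wf_digraph "hop_union G H"
    using wf_hop_union \<open>hopset G H\<close> wf_digraph by blast
  have "within_hops \<alpha> G w H (card (verts G))"
    unfolding within_hops_def
  proof (intro allI impI)
    fix s t assume "s \<rightarrow>\<^sup>*\<^bsub>G\<^esub> t"
    then obtain p where p: "apath s p t" "\<mu> w s t = ereal (awalk_cost w p)"
      using min_cost_awalk nonneg by blast
    have nn: "0 \<le> awalk_cost w p"
      using p(1) nonneg pos_cost_pos_awalk_cost by (auto simp: apath_def)
    have cost: "wf_digraph.awalk_cost (hop_weight G w) (map Inl p) = awalk_cost w p"
      by (simp add: awalk_cost_def U.awalk_cost_def hop_weight_def comp_def)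
    have "awalk_cost w p \<le> \<alpha> * awalk_cost w p"
      using mult_right_mono[OF \<open>\<alpha> \<ge> 1\<close> nn] by simp
    moreover have "length p \<le> card (verts G)"
      using length_apath[OF p(1)] by simp
    ultimately show "\<exists>p. pre_digraph.apath (hop_union G H) s p t \<and> length p \<le> card (verts G) \<and>
        ereal (wf_digraph.awalk_cost (hop_weight G w) p) \<le> ereal \<alpha> * \<mu> w s t"
      using apath_hop_union[OF p(1), of H] p(2) cost by (intro exI[of _ "map Inl p"]) simp
  qed
  then show ?thesis unfolding hopbound_def by (rule LeastI)
qed

end

theory Submission
  imports Defs
begin

text \<open>
  Take \<open>L + 1\<close> layers of width \<open>N = 2AL\<close>, where \<open>L = 2\<^sup>M\<close> and \<open>A\<close> is a constant multiple of \<open>C\<close>, so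
  that \<open>n\<close> is of order \<open>AL\<^sup>2\<close>. For a start height \<open>x\<close> and a direction \<open>\<phi>\<close>, both below \<open>AL\<close>, the path
  \<open>(x, \<phi>)\<close> climbs by \<open>(\<phi> + r\<^sub>i) div L\<close> between the layers \<open>i\<close> and \<open>i + 1\<close>, where \<open>r\<^sub>i\<close> is the
  bit reversal of \<open>i\<close>. The arc weights are powers of a large number, arranged so that an
  \<open>\<alpha>\<close>-approximate path between the ends of \<open>(x, \<phi>)\<close> can afford in each layer only the climbs up to
  that of \<open>(x, \<phi>)\<close>. As it has to reach the same final height, it visits only vertices of \<open>(x, \<phi>)\<close>.

  Since \<open>r\<close> is equidistributed on every aligned dyadic block, the climb over \<open>k\<close> consecutive layers
  strictly increases whenever \<open>\<phi>\<close> grows by a suitable \<open>O(L / k)\<close>. Hence two vertices that are \<open>k\<close>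
  layers apart lie on only \<open>O(L / k)\<close> common paths, and a hopset arc saves \<open>O(L)\<close> hops in total over all
  \<open>(AL)\<^sup>2\<close> paths. To shorten the average path below \<open>L / 2\<close> one needs of order \<open>A\<^sup>2L\<^sup>2\<close> arcs, which is more
  than \<open>Cn\<close>.
\<close>

section \<open>Bit reversal and directions\<close>

primrec bit_rev :: "nat \<Rightarrow> nat \<Rightarrow> nat" where
  "bit_rev 0 i = 0"
| "bit_rev (Suc M) i = (i mod 2) * 2 ^ M + bit_rev M (i div 2)"

lemma bit_rev_less: "bit_rev M i < 2 ^ M"
proof (induction M arbitrary: i)
  case (Suc M)
  have "(i mod 2) * 2 ^ M \<le> 1 * 2 ^ M"
    by (intro mult_right_mono) auto
  moreover have "bit_rev M (i div 2) < 2 ^ M" by (rule Suc)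
  ultimately have "(i mod 2) * 2 ^ M + bit_rev M (i div 2) < 1 * 2 ^ M + 2 ^ M"
    by (rule add_le_less_mono)
  then show ?case by simp
qed simp

text \<open>The leading \<open>m\<close> bits of \<open>bit_rev M i\<close> are the reversed low
  \<open>m\<close> bits of \<open>i\<close>, which take every value on an aligned block of length
  \<open>2 ^ m\<close>.\<close>

lemma bit_rev_block:
  assumes "m \<le> M" "t < 2 ^ m"
  shows "\<exists>i\<in>{c * 2 ^ m..<(c + 1) * 2 ^ m}. bit_rev M i div 2 ^ (M - m) = t"
  using assms
proof (induction m arbitrary: M t)
  case 0
  then show ?case using bit_rev_less[of M c] by auto
next
  case (Suc m)
  then obtain M' where M: "M = Suc M'" "m \<le> M'" by (cases M) auto
  obtain i where i: "c * 2 ^ m \<le> i" "i < (c + 1) * 2 ^ m" "bit_rev M' i div 2 ^ (M' - m) = t mod 2 ^ m"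
    using Suc.IH[OF M(2), of "t mod 2 ^ m"] by auto
  \<comment> \<open>The top bit of \<open>t\<close> has to be the lowest bit of the index, hence the
    witness \<open>2 * i + b\<close>.\<close>
  define b where "b = t div 2 ^ m"
  have b: "b < 2" using Suc.prems unfolding b_def by (simp add: less_mult_imp_div_less)
  have "2 ^ M' = (2 ^ m * 2 ^ (M' - m) :: nat)"
    using M by (simp flip: power_add)
  then have "b * 2 ^ M' + bit_rev M' i = bit_rev M' i + (b * 2 ^ m) * 2 ^ (M' - m)"
    by simp
  then have "(b * 2 ^ M' + bit_rev M' i) div 2 ^ (M' - m) = b * 2 ^ m + bit_rev M' i div 2 ^ (M' - m)"
    by (metis div_mult_self1 power_not_zero add.commute zero_neq_numeral)
  also have "\<dots> = t" unfolding i(3) b_def by (rule div_mult_mod_eq)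
  finally have "bit_rev M (2 * i + b) div 2 ^ (M - Suc m) = t"
    using b M by simp
  moreover have "c * 2 ^ Suc m \<le> 2 * i + b" using i(1) by simp
  moreover have "2 * i + b < (c + 1) * 2 ^ Suc m"
  proof -
    have "2 * i + b < 2 * (i + 1)" using b by simp
    also have "\<dots> \<le> 2 * ((c + 1) * 2 ^ m)" using i(2) by (intro mult_left_mono) auto
    also have "\<dots> = (c + 1) * 2 ^ Suc m" by (simp only: power_Suc mult_ac)
    finally show ?thesis .
  qed
  ultimately show ?case by (intro bexI[of _ "2 * i + b"]) (auto simp del: power_Suc)
qed

text \<open>
  The climb of direction \<open>\<phi>\<close> between layers \<open>i\<close> and \<open>i + 1\<close>.
\<close>

definition slope :: "nat \<Rightarrow> nat \<Rightarrow> nat \<Rightarrow> nat" where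
  "slope M \<phi> i = (\<phi> + bit_rev M i) div 2 ^ M"

definition shift :: "nat \<Rightarrow> nat \<Rightarrow> nat \<Rightarrow> nat" where
  "shift M \<phi> i = (\<Sum>k<i. slope M \<phi> k)"

lemma shift_0 [simp]: "shift M \<phi> 0 = 0"
  and shift_Suc [simp]: "shift M \<phi> (Suc i) = shift M \<phi> i + slope M \<phi> i"
  by (simp_all add: shift_def)

lemma shift_split: "i \<le> j \<Longrightarrow> shift M \<phi> j = shift M \<phi> i + (\<Sum>k=i..<j. slope M \<phi> k)"
  using sum.atLeastLessThan_concat[of 0 i j "slope M \<phi>"] by (simp add: shift_def lessThan_atLeast0)

lemma slope_mono: "\<phi> \<le> \<psi> \<Longrightarrow> slope M \<phi> i \<le> slope M \<psi> i"
  unfolding slope_def by (simp add: div_le_mono)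

lemma slope_le:
  assumes "\<phi> < A * 2 ^ M"
  shows "slope M \<phi> i \<le> A"
proof -
  have "\<phi> + bit_rev M i < (A + 1) * 2 ^ M"
    using assms bit_rev_less[of M i] by simp
  then have "slope M \<phi> i < A + 1"
    unfolding slope_def by (simp add: less_mult_imp_div_less)
  then show ?thesis by simp
qed

lemma shift_le:
  assumes "\<phi> < A * 2 ^ M"
  shows "shift M \<phi> i \<le> i * A"
  using sum_bounded_above[of "{..<i}" "slope M \<phi>" A] slope_le[OF assms] by (simp add: shift_def)

lemma ex_multiple:
  fixes b x :: nat
  assumes "b > 0"
  shows "\<exists>q. x \<le> q * b \<and> q * b < x + b"
proof -
  have "(x + b - 1) div b * b + (x + b - 1) mod b = x + b - 1" by (rule div_mult_mod_eq)
  moreover have "(x + b - 1) mod b < b" using assms by simp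
  ultimately show ?thesis using assms by (intro exI[of _ "(x + b - 1) div b"]) linarith
qed

text \<open>Slopes never fall as \<phi> grows, so one layer of the block with a strict rise is
  enough; \<open>bit_rev_block\<close> supplies it.\<close>

lemma slope_sum_gap:
  assumes "m \<le> M" "i \<le> c * 2 ^ m" "(c + 1) * 2 ^ m \<le> j"
  shows "(\<Sum>k=i..<j. slope M \<phi> k) < (\<Sum>k=i..<j. slope M (\<phi> + 2 * 2 ^ (M - m)) k)"
proof -
  define g :: nat where "g = 2 ^ (M - m)"
  have g: "g > 0" "2 ^ M = 2 ^ m * g" using assms(1) by (auto simp: g_def simp flip: power_add)
  define s where "s = \<phi> div g"
  txt \<open>
    Some \<open>k\<close> in the block has its leading bits such that a multiple of \<open>2\<^sup>M\<close> lies in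
    \<open>(\<phi> + bit_rev M k, \<phi> + 2 g + bit_rev M k]\<close>; the factor 2 absorbs the carry of the low-order bits.
  \<close>
  obtain q where q: "s + 2 \<le> q * 2 ^ m" "q * 2 ^ m < s + 2 + 2 ^ m"
    using ex_multiple[of "2 ^ m" "s + 2"] by auto
  define t where "t = q * 2 ^ m - (s + 2)"
  have t: "t < 2 ^ m" "s + 2 + t = q * 2 ^ m"
    unfolding t_def using q by linarith+
  obtain k where k: "c * 2 ^ m \<le> k" "k < (c + 1) * 2 ^ m" "bit_rev M k div g = t"
    using bit_rev_block[OF assms(1) t(1), of c] by (auto simp: g_def)
  have ms: "\<phi> = s * g + \<phi> mod g" "bit_rev M k = t * g + bit_rev M k mod g"
    using k(3) by (auto simp: s_def)
  have lt: "\<phi> mod g < g" "bit_rev M k mod g < g" using g by auto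
  have qL: "q * 2 ^ M = s * g + t * g + 2 * g"
    using t(2) g(2) by (metis add.commute add.left_commute distrib_right mult.assoc)
  have "\<phi> + bit_rev M k < q * 2 ^ M" using ms lt qL by linarith
  then have "slope M \<phi> k < q" unfolding slope_def by (simp add: less_mult_imp_div_less)
  moreover have "q * 2 ^ M \<le> \<phi> + 2 * g + bit_rev M k" using ms qL by linarith
  then have "q \<le> slope M (\<phi> + 2 * g) k"
    unfolding slope_def by (simp add: less_eq_div_iff_mult_less_eq)
  ultimately have "slope M \<phi> k < slope M (\<phi> + 2 * g) k" by linarith
  moreover have "k \<in> {i..<j}" using k assms by auto
  ultimately show ?thesis
    unfolding g_def[symmetric] by (intro sum_strict_mono_ex1) (auto intro: slope_mono)
qed

lemma aligned_block:
  fixes i j :: nat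
  assumes "i < j"
  obtains c m where "i \<le> c * 2 ^ m" "(c + 1) * 2 ^ m \<le> j" "j - i \<le> 4 * 2 ^ m"
proof -
  define k where "k = j - i"
  \<comment> \<open>The first multiple of \<open>2 ^ m\<close> from \<open>i\<close> on may come
    \<open>2 ^ m - 1\<close> later, so the block fits if \<open>2 * 2 ^ m - 1 \<le> k\<close>. Hence
    the comparison with \<open>k + 1\<close>, and \<open>m\<close> one below
    \<open>n\<close>.\<close>
  obtain n where n: "2 ^ n \<le> k + 1" "k + 1 < 2 ^ (n + 1)"
    using ex_power_ivl1[of 2 "k + 1"] by auto
  have "n \<noteq> 0"
  proof
    assume "n = 0"
    then show False using n(2) assms by (simp add: k_def)
  qed
  then obtain m where m: "n = Suc m" by (cases n) auto
  have p: "(1::nat) \<le> 2 ^ m" by simp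
  obtain c where c: "i \<le> c * 2 ^ m" "c * 2 ^ m < i + 2 ^ m"
    using ex_multiple[of "2 ^ m" i] by auto
  show thesis
  proof
    show "i \<le> c * 2 ^ m" by (rule c)
    have "(c + 1) * 2 ^ m \<le> i + 2 ^ m - 1 + 2 ^ m" using c(2) p by simp
    also have "\<dots> \<le> i + k" using n(1) m p by simp
    finally show "(c + 1) * 2 ^ m \<le> j" using assms by (simp add: k_def)
    show "j - i \<le> 4 * 2 ^ m" using n(2) m by (simp add: k_def)
  qed
qed

text \<open>By \<open>slope_sum_gap\<close>, directions with equal climbs differ by less than
  \<open>2 * 2 ^ (M - m)\<close>, where \<open>2 ^ m\<close> is the length of an aligned block
  between \<open>i\<close> and \<open>j\<close> and at least a quarter of
  \<open>j - i\<close>.\<close>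

lemma card_slope_sum_eq:
  assumes "i < j" "j \<le> 2 ^ M" "finite F" and F: "\<And>\<phi>. \<phi> \<in> F \<Longrightarrow> (\<Sum>k=i..<j. slope M \<phi> k) = d"
  shows "(j - i) * card F \<le> 8 * 2 ^ M"
proof (cases "F = {}")
  case False
  obtain c m where cm: "i \<le> c * 2 ^ m" "(c + 1) * 2 ^ m \<le> j" "j - i \<le> 4 * 2 ^ m"
    using aligned_block[OF assms(1)] .
  have "(2::nat) ^ m \<le> 2 ^ M" using cm(2) assms(2) unfolding add_mult_distrib mult_1 by linarith
  then have m: "m \<le> M" by (rule power_le_imp_le_exp[rotated]) simp
  define g :: nat where "g = 2 ^ (M - m)"
  have "F \<subseteq> {Min F..<Min F + 2 * g}"
  proof
    fix \<phi> assume "\<phi> \<in> F"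
    moreover have "\<phi> < Min F + 2 * g"
    proof (rule ccontr)
      assume "\<not> \<phi> < Min F + 2 * g"
      then have "(\<Sum>k=i..<j. slope M (Min F + 2 * g) k) \<le> (\<Sum>k=i..<j. slope M \<phi> k)"
        by (intro sum_mono slope_mono) auto
      moreover have "(\<Sum>k=i..<j. slope M (Min F) k) < (\<Sum>k=i..<j. slope M (Min F + 2 * g) k)"
        unfolding g_def by (rule slope_sum_gap[OF m cm(1,2)])
      ultimately show False using F[of "Min F"] F[OF \<open>\<phi> \<in> F\<close>] Min_in assms False by auto
    qed
    ultimately show "\<phi> \<in> {Min F..<Min F + 2 * g}" using assms by simp
  qed
  then have "card F \<le> 2 * g"
    using card_mono[of "{Min F..<Min F + 2 * g}" F] by simp
  then have "(j - i) * card F \<le> (4 * 2 ^ m) * (2 * g)" using cm(3) by (rule mult_le_mono[rotated])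
  also have "\<dots> = 8 * 2 ^ M" using m by (simp add: g_def flip: power_add)
  finally show ?thesis .
qed simp

section \<open>Potentials along walks\<close>

context wf_digraph
begin

lemma awalk_nonincreasing:
  fixes f :: "'a \<Rightarrow> 'c :: order"
  assumes "awalk u p v" "\<And>e. e \<in> set p \<Longrightarrow> f (head G e) \<le> f (tail G e)"
  shows "f v \<le> f u"
  using assms
proof (induction p arbitrary: u)
  case (Cons e p)
  then have "f v \<le> f (head G e)" by (simp add: awalk_Cons_iff)
  also have "\<dots> \<le> f u" using Cons.prems by (auto simp: awalk_Cons_iff)
  finally show ?case .
qed (simp add: awalk_Nil_iff)

lemma awalk_constant:
  fixes f :: "'a \<Rightarrow> 'c :: order"
  assumes "awalk u p v" "\<And>e. e \<in> set p \<Longrightarrow> f (head G e) \<le> f (tail G e)" "f u \<le> f v" "e \<in> set p"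
  shows "f (tail G e) = f u" "f (head G e) = f u"
proof -
  obtain q r where p: "p = q @ e # r" using assms(4) by (auto simp: in_set_conv_decomp)
  have w: "awalk u q (tail G e)" "awalk (head G e) r v"
    using assms(1) unfolding p by (auto simp: awalk_Cons_iff)
  have "f (tail G e) \<le> f u" "f v \<le> f (head G e)" "f (head G e) \<le> f (tail G e)"
    using awalk_nonincreasing[OF w(1), of f] awalk_nonincreasing[OF w(2), of f] assms(2)
    unfolding p by auto
  then show "f (tail G e) = f u" "f (head G e) = f u"
    using assms(3) by (metis order.trans order.antisym)+
qed

text \<open>Truncated subtraction counts a fall as zero, hence only an inequality. It is applied to
  layer numbers.\<close>

lemma awalk_increments:
  fixes f :: "'a \<Rightarrow> nat"
  assumes "awalk u p v"
  shows "f v \<le> f u + (\<Sum>e\<leftarrow>p. f (head G e) - f (tail G e))"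
  using assms
proof (induction p arbitrary: u)
  case (Cons e p)
  then have "f v \<le> f (head G e) + (\<Sum>e\<leftarrow>p. f (head G e) - f (tail G e))" "u = tail G e"
    by (auto simp: awalk_Cons_iff)
  then show ?case by simp
qed (simp add: awalk_Nil_iff)

end

section \<open>The layered graph\<close>

locale layered_graph =
  fixes M A n :: nat and \<alpha> :: real
  assumes A_pos: "A > 0" and \<alpha>_ge_1: "\<alpha> \<ge> 1" and n_ge: "(2 ^ M + 1) * (2 * A * 2 ^ M) \<le> n"
begin

definition L :: nat where "L = 2 ^ M"
text \<open>Room for a start height below \<open>A * L\<close> and \<open>L\<close> climbs of at
  most \<open>A\<close> each.\<close>

definition N :: nat where "N = 2 * A * L"
text \<open>As \<open>W > \<alpha> * L\<close>, even \<alpha> times \<open>L\<close> arcs of weight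
  \<open>W ^ e\<close> cost less than one arc of weight \<open>W ^ (e + 1)\<close>.\<close>

definition W :: real where "W = \<alpha> * L + 1"

text \<open>
  The vertex \<open>u\<close> sits in layer \<open>u div N\<close> at height \<open>u mod N\<close>. The vertices from \<open>(L + 1) N\<close> on are isolated and
  only pad their number to \<open>n\<close>.
\<close>

definition G :: "(nat, nat \<times> nat) pre_digraph" where
  "G = \<lparr>verts = {..<n},
        arcs = {(u, v). u div N < L \<and> v div N = Suc (u div N) \<and> u mod N \<le> v mod N},
        tail = fst, head = snd\<rparr>"

text \<open>
  The subtraction of the bit reversal, which is below \<open>L\<close>, does not truncate. The exponent is at most
  \<open>\<phi> + L\<close> iff the arc climbs by at most \<open>slope M \<phi>\<close>.
\<close>

definition weight_exp :: "nat \<times> nat \<Rightarrow> nat" where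
  "weight_exp = (\<lambda>(u, v). (v mod N - u mod N + 1) * L - bit_rev M (u div N))"

definition weight :: "nat \<times> nat \<Rightarrow> real" where
  "weight e = W ^ weight_exp e"

text \<open>
  The height relative to the path of direction \<open>\<phi>\<close> from height \<open>0\<close>. It never increases along arcs that
  are affordable for \<open>\<phi>\<close>.
\<close>

definition potential :: "nat \<Rightarrow> nat \<Rightarrow> int" where
  "potential \<phi> u = int (u mod N) - int (shift M \<phi> (u div N))"

definition span :: "nat \<times> nat \<Rightarrow> nat" where
  "span = (\<lambda>(u, v). v div N - u div N)"

text \<open>Potential \<open>x\<close> means that a vertex in layer \<open>i\<close> is
  \<open>canon x \<phi> i\<close>, so these are the canonical paths that contain both
  \<open>u\<close> and \<open>v\<close>.\<close>

definition through :: "nat \<times> nat \<Rightarrow> (nat \<times> nat) set" where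
  "through = (\<lambda>(u, v). {(x, \<phi>). x < A * L \<and> \<phi> < A * L \<and>
     potential \<phi> u = int x \<and> potential \<phi> v = int x})"

definition canon :: "nat \<Rightarrow> nat \<Rightarrow> nat \<Rightarrow> nat" where
  "canon x \<phi> i = i * N + (x + shift M \<phi> i)"

section \<open>Affordable arcs and the potential\<close>

lemma L_pos: "L > 0" and N_pos: "N > 0" and W_gt_1: "W > 1"
  using A_pos \<alpha>_ge_1 by (auto simp: L_def N_def W_def)

lemma layer_less:
  assumes "v div N \<le> L"
  shows "v < n"
proof -
  have "v < Suc (v div N) * N" using N_pos by (rule dividend_less_div_times[THEN order_less_le_trans]) simp
  also have "\<dots> \<le> (L + 1) * N" using assms by simp
  also have "\<dots> \<le> n" using n_ge by (simp add: L_def N_def)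
  finally show ?thesis .
qed

lemma G_simps [simp]: "verts G = {..<n}" "tail G = fst" "head G = snd"
  by (simp_all add: G_def)

lemma arc_iff: "(u, v) \<in> arcs G \<longleftrightarrow> u div N < L \<and> v div N = Suc (u div N) \<and> u mod N \<le> v mod N"
  by (simp add: G_def)

lemma digraph_G: "digraph G"
proof
  have *: "u < n \<and> v < n" if "(u, v) \<in> arcs G" for u v
    using that layer_less[of u] layer_less[of v] by (simp add: arc_iff)
  show "tail G e \<in> verts G" if "e \<in> arcs G" for e using * that by (cases e) auto
  show "head G e \<in> verts G" if "e \<in> arcs G" for e using * that by (cases e) auto
  have "arcs G \<subseteq> {..<n} \<times> {..<n}" using * by auto
  then show "finite (arcs G)" by (rule finite_subset) simp
  show "tail G e \<noteq> head G e" if "e \<in> arcs G" for e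
  proof
    assume "tail G e = head G e"
    with that show False by (cases e) (auto simp: arc_iff)
  qed
  show "e1 = e2" if "arc_to_ends G e1 = arc_to_ends G e2" for e1 e2
    using that by (auto simp: arc_to_ends_def prod_eq_iff)
qed auto

sublocale G: digraph G
  by (rule digraph_G)

lemma weight_pos: "weight e > 0"
  using W_gt_1 by (simp add: weight_def)

lemma weight_exp_le_iff:
  "weight_exp (u, v) \<le> \<phi> + L \<longleftrightarrow> v mod N - u mod N \<le> slope M \<phi> (u div N)"
proof -
  have "weight_exp (u, v) \<le> \<phi> + L \<longleftrightarrow> (v mod N - u mod N) * L \<le> \<phi> + bit_rev M (u div N)"
    unfolding weight_exp_def by (auto simp: algebra_simps)
  also have "\<dots> \<longleftrightarrow> v mod N - u mod N \<le> slope M \<phi> (u div N)"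
    using L_pos by (simp add: slope_def L_def less_eq_div_iff_mult_less_eq)
  finally show ?thesis .
qed

text \<open>Such an arc has exponent at most \<open>\<phi> + L\<close>, so it climbs by at most the
  slope by which the shift grows.\<close>

lemma potential_arc_le:
  assumes "e \<in> arcs G" "weight e < W ^ (\<phi> + L + 1)"
  shows "potential \<phi> (snd e) \<le> potential \<phi> (fst e)"
proof -
  obtain u v where e: "e = (u, v)" by fastforce
  have "weight_exp e < \<phi> + L + 1"
    using assms(2) W_gt_1 unfolding weight_def by (metis power_less_imp_less_exp)
  then have "v mod N - u mod N \<le> slope M \<phi> (u div N)"
    using weight_exp_le_iff[of u v \<phi>] e by simp
  then show ?thesis
    using assms(1) unfolding e by (auto simp: arc_iff potential_def)
qed

lemma potential_awalk_le:
  assumes "G.awalk u p v" "G.awalk_cost weight p < W ^ (\<phi> + L + 1)"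
  shows "potential \<phi> v \<le> potential \<phi> u"
proof (rule G.awalk_nonincreasing[OF assms(1)])
  fix e assume e: "e \<in> set p"
  have "weight e \<le> G.awalk_cost weight p"
    unfolding G.awalk_cost_def using e weight_pos
    by (intro member_le_sum_list) (auto intro: less_imp_le)
  then show "potential \<phi> (head G e) \<le> potential \<phi> (tail G e)"
    using e assms G.awalkE by (auto intro!: potential_arc_le)
qed

section \<open>Canonical paths and their cost\<close>

lemma canon_bound:
  assumes "x < A * L" "\<phi> < A * L" "i \<le> L"
  shows "x + shift M \<phi> i < N"
proof -
  have "shift M \<phi> i \<le> i * A" using shift_le assms(2) by (simp add: L_def)
  also have "\<dots> \<le> A * L" using assms(3) by (simp add: mult.commute)
  finally show ?thesis using assms(1) by (simp add: N_def)
qed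

lemma canon_simps:
  assumes "x < A * L" "\<phi> < A * L" "i \<le> L"
  shows "canon x \<phi> i div N = i" "canon x \<phi> i mod N = x + shift M \<phi> i" "canon x \<phi> i < n"
    "potential \<phi> (canon x \<phi> i) = int x"
proof -
  show *: "canon x \<phi> i div N = i" "canon x \<phi> i mod N = x + shift M \<phi> i"
    using canon_bound[OF assms] by (simp_all add: canon_def)
  show "canon x \<phi> i < n" by (rule layer_less) (simp add: * assms)
  show "potential \<phi> (canon x \<phi> i) = int x" by (simp add: potential_def *)
qed

lemma canon_walk:
  assumes "x < A * L" "\<phi> < A * L" "i \<le> L"
  shows "\<exists>p. G.awalk (canon x \<phi> 0) p (canon x \<phi> i) \<and> G.awalk_cost weight p \<le> i * W ^ (\<phi> + L)"
  using assms(3)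
proof (induction i)
  case 0
  then show ?case using canon_simps[OF assms(1,2), of 0]
    by (intro exI[of _ "[]"]) (simp add: G.awalk_Nil_iff)
next
  case (Suc i)
  then obtain p where p: "G.awalk (canon x \<phi> 0) p (canon x \<phi> i)" "G.awalk_cost weight p \<le> i * W ^ (\<phi> + L)"
    by auto
  let ?e = "(canon x \<phi> i, canon x \<phi> (Suc i))"
  note c = canon_simps[OF assms(1,2), of i] canon_simps[OF assms(1,2), of "Suc i"]
  have e: "?e \<in> arcs G" using Suc c by (simp add: arc_iff)
  then have "G.awalk (canon x \<phi> i) [?e] (canon x \<phi> (Suc i))"
    using G.arc_implies_awalk[OF e] by simp
  moreover have "weight_exp ?e \<le> \<phi> + L"
    unfolding weight_exp_le_iff using Suc c by simp
  then have "weight ?e \<le> W ^ (\<phi> + L)"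
    unfolding weight_def using W_gt_1 by (intro power_increasing) auto
  ultimately show ?case using p
    by (intro exI[of _ "p @ [?e]"]) (auto simp: algebra_simps intro: G.awalk_appendI)
qed

text \<open>The canonical path has \<open>L\<close> arcs of weight at most
  \<open>W ^ (\<phi> + L)\<close>, and \<open>\<alpha> * L < W\<close>: the whole budget cannot pay
  for a single arc steeper than the slope.\<close>

lemma canon_dist:
  assumes "x < A * L" "\<phi> < A * L"
  shows "canon x \<phi> 0 \<rightarrow>\<^sup>*\<^bsub>G\<^esub> canon x \<phi> L"
    and "ereal \<alpha> * G.\<mu> weight (canon x \<phi> 0) (canon x \<phi> L) < ereal (W ^ (\<phi> + L + 1))"
proof -
  obtain p where p: "G.awalk (canon x \<phi> 0) p (canon x \<phi> L)" "G.awalk_cost weight p \<le> L * W ^ (\<phi> + L)"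
    using canon_walk[OF assms, of L] by auto
  then show "canon x \<phi> 0 \<rightarrow>\<^sup>*\<^bsub>G\<^esub> canon x \<phi> L" by (blast intro: G.reachable_awalkI)
  have "G.\<mu> weight (canon x \<phi> 0) (canon x \<phi> L) \<le> ereal (L * W ^ (\<phi> + L))"
    using G.min_cost_le_walk_cost[OF p(1), of weight] p(2) order_trans by fastforce
  then have "ereal \<alpha> * G.\<mu> weight (canon x \<phi> 0) (canon x \<phi> L) \<le> ereal \<alpha> * ereal (L * W ^ (\<phi> + L))"
    using \<alpha>_ge_1 by (intro ereal_mult_left_mono) auto
  also have "\<dots> < ereal (W ^ (\<phi> + L + 1))"
    using W_gt_1 by (simp add: W_def algebra_simps)
  finally show "ereal \<alpha> * G.\<mu> weight (canon x \<phi> 0) (canon x \<phi> L) < ereal (W ^ (\<phi> + L + 1))" .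
qed

section \<open>Canonical paths shared by two vertices\<close>

lemma reachable_layer:
  assumes "u \<rightarrow>\<^sup>*\<^bsub>G\<^esub> v"
  shows "v = u \<or> v div N \<le> L"
  using assms
proof (induction rule: G.reachable_induct)
  case (step x y)
  then show ?case by (auto simp: arc_iff arcs_ends_def arc_to_ends_def)
qed simp

text \<open>The potential at the tail of \<open>h\<close> determines \<open>x\<close> from \<phi>,
  so counting paths is counting directions, and all of these climb equally between the two
  layers.\<close>

lemma span_card_through:
  assumes "fst h \<rightarrow>\<^sup>*\<^bsub>G\<^esub> snd h"
  shows "span h * card (through h) \<le> 8 * L"
proof (cases "span h = 0")
  case False
  obtain u v where h: "h = (u, v)" by fastforce
  define i j where "i = u div N" and "j = v div N"
  have "u \<noteq> v" using False h by (auto simp: span_def)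
  then have ij: "i < j" "j \<le> L" "span h = j - i"
    using False reachable_layer[OF assms] unfolding h i_def j_def span_def by auto
  have inj: "inj_on snd (through h)"
    by (auto simp: inj_on_def through_def h)
  have fin: "finite (through h)"
    by (rule finite_subset[of _ "{..<A * L} \<times> {..<A * L}"]) (auto simp: through_def h)
  have "(\<Sum>k=i..<j. slope M \<phi> k) = v mod N - u mod N" if "\<phi> \<in> snd ` through h" for \<phi>
  proof -
    have "int (u mod N) - int (shift M \<phi> i) = int (v mod N) - int (shift M \<phi> j)"
      using that unfolding through_def h potential_def i_def j_def by auto
    then show ?thesis using shift_split[of i j M \<phi>] ij(1) by linarith
  qed
  then have "(j - i) * card (snd ` through h) \<le> 8 * 2 ^ M"
    using ij fin by (intro card_slope_sum_eq) (auto simp: L_def)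
  then show ?thesis using ij by (simp add: card_image[OF inj] L_def)
qed simp

section \<open>Counting the hops that a hopset saves\<close>

context
  fixes H assumes hopset: "hopset G H"
begin

interpretation U: wf_digraph "hop_union G H"
  by (rule wf_hop_union[OF G.wf_digraph hopset])

text \<open>The distance is attained, so bounds for walks in \<open>G\<close> carry over to hopset
  arcs.\<close>

lemma hop_cost:
  assumes "(u, v) \<in> H"
  obtains p where "G.awalk u p v" "hop_weight G weight (Inr (u, v)) = G.awalk_cost weight p"
proof -
  have "u \<rightarrow>\<^sup>*\<^bsub>G\<^esub> v" using assms hopset by (auto simp: hopset_def)
  then obtain p where "G.apath u p v" "G.\<mu> weight u v = ereal (G.awalk_cost weight p)"
    using G.min_cost_awalk[of u v weight] weight_pos less_imp_le by blast
  then show thesis using that by (auto simp: hop_weight_def pre_digraph.apath_def)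
qed

lemma hop_weight_nonneg:
  assumes "e \<in> arcs (hop_union G H)"
  shows "0 \<le> hop_weight G weight e"
proof (cases e)
  case (Inl a)
  then show ?thesis by (simp add: hop_weight_def weight_pos less_imp_le)
next
  case (Inr h)
  moreover obtain u v where "h = (u, v)" by fastforce
  ultimately have e: "e = Inr (u, v)" "(u, v) \<in> H" using assms by (auto simp: hop_union_def)
  show ?thesis using hop_cost[OF e(2)] e(1)
    by (metis G.pos_cost_pos_awalk_cost weight_pos less_imp_le)
qed

lemma potential_hop_le:
  assumes "e \<in> arcs (hop_union G H)" "hop_weight G weight e < W ^ (\<phi> + L + 1)"
  shows "potential \<phi> (head (hop_union G H) e) \<le> potential \<phi> (tail (hop_union G H) e)"
proof (cases e)
  case (Inl a)
  then show ?thesis using assms potential_arc_le[of a \<phi>] by (auto simp: hop_union_def hop_weight_def)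
next
  case (Inr h)
  moreover obtain u v where "h = (u, v)" by fastforce
  ultimately have e: "e = Inr (u, v)" "(u, v) \<in> H" using assms by (auto simp: hop_union_def)
  obtain p where "G.awalk u p v" "hop_weight G weight e = G.awalk_cost weight p"
    using hop_cost[OF e(2)] e(1) by metis
  then show ?thesis using potential_awalk_le[of u p v \<phi>] assms e by (simp add: hop_union_def)
qed

text \<open>Within the budget no arc raises the potential. Being \<open>x\<close> at both ends, it
  is constant, so every hopset arc used has both ends on the canonical path. The other arcs advance
  by one layer only.\<close>

lemma hop_path_bound:
  assumes "within_hops \<alpha> G weight H \<beta>" "finite H" "x < A * L" "\<phi> < A * L"
  shows "L \<le> \<beta> + (\<Sum>h\<in>H. if (x, \<phi>) \<in> through h then span h else 0)"
proof -
  let ?U = "hop_union G H"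
  let ?s = "canon x \<phi> 0" and ?t = "canon x \<phi> L"
  obtain p where p: "U.apath ?s p ?t" "length p \<le> \<beta>"
    "ereal (U.awalk_cost (hop_weight G weight) p) \<le> ereal \<alpha> * G.\<mu> weight ?s ?t"
    using assms(1) canon_dist(1)[OF assms(3,4)] unfolding within_hops_def
    by (metis G.awalk_cost_def U.awalk_cost_def)
  have w: "U.awalk ?s p ?t" and dist: "distinct p"
    using p(1) U.distinct_verts_imp_distinct by (auto simp: U.apath_def)
  have arcs: "set p \<subseteq> arcs ?U" using w by (auto simp: U.awalk_def)
  have "U.awalk_cost (hop_weight G weight) p < W ^ (\<phi> + L + 1)"
    using le_less_trans[OF p(3) canon_dist(2)[OF assms(3,4)]] by simp
  moreover have "hop_weight G weight e \<le> U.awalk_cost (hop_weight G weight) p" if "e \<in> set p" for e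
    unfolding U.awalk_cost_def using that hop_weight_nonneg arcs
    by (intro member_le_sum_list) auto
  ultimately have noninc: "potential \<phi> (head ?U e) \<le> potential \<phi> (tail ?U e)" if "e \<in> set p" for e
    using that arcs by (intro potential_hop_le) force+
  have ends: "potential \<phi> ?s = int x" "potential \<phi> ?t = int x" "?s div N = 0" "?t div N = L"
    using canon_simps[OF assms(3,4)] by auto
  define P where "P = {h. Inr h \<in> set p}"
  have "P \<subseteq> H" using arcs by (auto simp: P_def hop_union_def)
  have through: "(x, \<phi>) \<in> through h" if "h \<in> P" for h
    using U.awalk_constant[OF w noninc, of "Inr h"] that ends assms(3,4)
    by (auto simp: P_def through_def hop_union_def split: prod.splits)
  define g :: "(nat \<times> nat) + nat \<times> nat \<Rightarrow> nat" where "g = case_sum (\<lambda>_. 0) span"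
  \<comment> \<open>Hopset arcs are granted one layer too many, so that \<open>length p\<close>
    splits off uniformly.\<close>
  have "head ?U e div N - tail ?U e div N \<le> 1 + g e" if "e \<in> set p" for e
    using that arcs by (cases e) (auto simp: hop_union_def g_def span_def arc_iff)
  then have "(\<Sum>e\<leftarrow>p. head ?U e div N - tail ?U e div N) \<le> (\<Sum>e\<leftarrow>p. 1 + g e)"
    by (rule sum_list_mono)
  then have "L \<le> (\<Sum>e\<leftarrow>p. 1 + g e)"
    using U.awalk_increments[OF w, of "\<lambda>u. u div N"] ends by simp
  \<comment> \<open>A path repeats no arc, so each hopset arc is counted once.\<close>
  also have "\<dots> = length p + (\<Sum>e\<in>set p. g e)"
    using dist by (simp only: sum_list_addf sum_list_triv sum_list_distinct_conv_sum_set) simp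
  also have "(\<Sum>e\<in>set p. g e) = (\<Sum>e\<in>Inr ` P. g e)"
    by (rule sum.mono_neutral_right) (auto simp: P_def g_def split: sum.splits)
  also have "\<dots> = (\<Sum>h\<in>P. span h)"
    by (subst sum.reindex) (auto simp: g_def)
  also have "\<dots> = (\<Sum>h\<in>P. if (x, \<phi>) \<in> through h then span h else 0)"
    using through by (intro sum.cong) auto
  also have "\<dots> \<le> (\<Sum>h\<in>H. if (x, \<phi>) \<in> through h then span h else 0)"
    using assms(2) \<open>P \<subseteq> H\<close> by (intro sum_mono2) auto
  finally show ?thesis using p(2) by simp
qed

text \<open>Sum \<open>hop_path_bound\<close> over all starts and directions and swap the sums: each
  hopset arc contributes \<open>span h * card (through h)\<close>.\<close>

lemma hopset_count:
  assumes "within_hops \<alpha> G weight H \<beta>"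
  shows "A * L * (A * L) * L \<le> A * L * (A * L) * \<beta> + card H * (8 * L)"
proof -
  have reach: "fst h \<rightarrow>\<^sup>*\<^bsub>G\<^esub> snd h" if "h \<in> H" for h
    using hopset that by (auto simp: hopset_def)
  \<comment> \<open>An infinite set would have \<open>card\<close> 0; reachability rules this out by
    confining both ends to the vertices.\<close>
  have "H \<subseteq> {..<n} \<times> {..<n}"
    using reach G.reachable_in_verts by fastforce
  then have fin: "finite H" by (rule finite_subset) simp
  define I where "I = {..<A * L} \<times> {..<A * L}"
  have I: "finite I" "card I = A * L * (A * L)" by (auto simp: I_def)
  have "card I * L = (\<Sum>y\<in>I. L)" by simp
  also have "\<dots> \<le> (\<Sum>y\<in>I. \<beta> + (\<Sum>h\<in>H. if y \<in> through h then span h else 0))"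
    using hop_path_bound[OF assms fin] by (intro sum_mono) (auto simp: I_def)
  also have "\<dots> = card I * \<beta> + (\<Sum>h\<in>H. \<Sum>y\<in>I. if y \<in> through h then span h else 0)"
    by (simp add: sum.distrib) (rule sum.swap)
  also have "(\<Sum>h\<in>H. \<Sum>y\<in>I. if y \<in> through h then span h else 0) \<le> (\<Sum>h\<in>H. 8 * L)"
  proof (rule sum_mono)
    fix h assume "h \<in> H"
    have "I \<inter> {y. y \<in> through h} = through h" by (auto simp: I_def through_def split: prod.splits)
    then have "(\<Sum>y\<in>I. if y \<in> through h then span h else 0) = span h * card (through h)"
      using I by (simp add: sum.If_cases)
    then show "(\<Sum>y\<in>I. if y \<in> through h then span h else 0) \<le> 8 * L"
      using span_card_through reach[OF \<open>h \<in> H\<close>] by simp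
  qed
  finally show ?thesis using I by simp
qed

end

end

section \<open>The lower bound\<close>

lemma hopbound_pos:
  assumes "fin_digraph G" "\<And>e. e \<in> arcs G \<Longrightarrow> 0 \<le> w e" "\<alpha> \<ge> 1" "hopset G H"
    and "s \<rightarrow>\<^sup>*\<^bsub>G\<^esub> t" "s \<noteq> t"
  shows "hopbound \<alpha> G w H \<ge> 1"
proof -
  obtain p where p: "pre_digraph.apath (hop_union G H) s p t" "length p \<le> hopbound \<alpha> G w H"
    using within_hops_hopbound[of G w \<alpha> H] assms unfolding within_hops_def by blast
  have "p \<noteq> []"
    using p(1) assms(6) by (auto simp: pre_digraph.apath_def pre_digraph.awalk_def pre_digraph.cas.simps)
  then show ?thesis using p(2) by (cases p) auto
qed

text \<open>Serves the values of \<open>n\<close> too small for the layers, where hopbound 1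
  suffices.\<close>

lemma single_arc_hopbound:
  assumes "n \<ge> 2"
  obtains G :: "(nat, nat \<times> nat) pre_digraph"
  where "digraph G" "card (verts G) = n" "\<And>\<alpha> H. \<alpha> \<ge> 1 \<Longrightarrow> hopset G H \<Longrightarrow> hopbound \<alpha> G (\<lambda>_. 1) H \<ge> 1"
proof
  let ?G = "\<lparr>verts = {..<n}, arcs = {(0, 1)}, tail = fst, head = snd\<rparr> :: (nat, nat \<times> nat) pre_digraph"
  show G: "digraph ?G"
    using assms by unfold_locales (auto simp: arc_to_ends_def)
  interpret digraph ?G by (rule G)
  show "card (verts ?G) = n" by simp
  have "awalk 0 [(0, 1)] 1" using arc_implies_awalk[of "(0, 1)"] by simp
  then have "0 \<rightarrow>\<^sup>*\<^bsub>?G\<^esub> 1" by (rule reachable_awalkI)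
  then show "hopbound \<alpha> ?G (\<lambda>_. 1) H \<ge> 1" if "\<alpha> \<ge> 1" "hopset ?G H" for \<alpha> H
    using that by (intro hopbound_pos[OF fin_digraph_axioms]) auto
qed

text \<open>The hopset saves at most \<open>8 * L * C * 12 * A * L ^ 2 = 96 * C * A * L ^ 3\<close>
  hops. By \<open>192 * C \<le> A\<close> this is at most half of the \<open>A ^ 2 * L ^ 3\<close>
  layer steps of all canonical paths.\<close>

lemma (in layered_graph) hopbound_ge:
  fixes C :: real
  assumes C: "192 * C \<le> real A" and H: "hopset G H" "real (card H) \<le> C * n" and n: "n \<le> 12 * A * L ^ 2"
    and "C > 0"
  shows "real (hopbound \<alpha> G weight H) \<ge> L / 2"
proof -
  define \<beta> where "\<beta> = hopbound \<alpha> G weight H"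
  have "within_hops \<alpha> G weight H \<beta>"
    unfolding \<beta>_def using H(1) \<alpha>_ge_1 weight_pos
    by (intro within_hops_hopbound) (auto intro: G.fin_digraph_axioms less_imp_le)
  from hopset_count[OF H(1) this]
  have "real (A * L * (A * L) * L) \<le> real (A * L * (A * L) * \<beta> + card H * (8 * L))"
    by (rule of_nat_mono)
  then have "real A ^ 2 * real L ^ 3 \<le> real A ^ 2 * real L ^ 2 * \<beta> + real (card H) * (8 * L)"
    by (simp add: power2_eq_square power3_eq_cube mult_ac)
  also have "real (card H) * (8 * L) \<le> (C * (12 * A * L ^ 2)) * (8 * L)"
  proof (rule mult_right_mono)
    have "C * real n \<le> C * real (12 * A * L ^ 2)"
      using n \<open>C > 0\<close> by (intro mult_left_mono) (auto simp del: of_nat_mult)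
    then show "real (card H) \<le> C * (12 * A * L ^ 2)" using H(2) by simp
  qed simp
  also have "(C * (12 * A * L ^ 2)) * (8 * L) = (192 * C) * (A * real L ^ 3 / 2)"
    by (simp add: power2_eq_square power3_eq_cube)
  also have "\<dots> \<le> real A * (A * real L ^ 3 / 2)"
    using C by (intro mult_right_mono) auto
  finally have "real A ^ 2 * real L ^ 2 * (L / 2) \<le> real A ^ 2 * real L ^ 2 * \<beta>"
    by (simp add: power2_eq_square power3_eq_cube)
  then show ?thesis
    unfolding \<beta>_def using A_pos L_pos by (simp add: mult_le_cancel_left)
qed

lemma ex_maximal_layers:
  fixes A n :: nat
  assumes "A > 0" "4 * A \<le> n"
  obtains M where "(2 ^ M + 1) * (2 * A * 2 ^ M) \<le> n" "n \<le> 12 * A * (2 ^ M) ^ 2"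
proof -
  define f :: "nat \<Rightarrow> nat" where "f M = (2 ^ M + 1) * (2 * A * 2 ^ M)" for M
  have "\<exists>M. f M \<le> n \<and> \<not> f (Suc M) \<le> n"
  proof (rule ccontr)
    assume "\<not> ?thesis"
    moreover have "f 0 \<le> n" using assms by (simp add: f_def)
    ultimately have "f M \<le> n" for M by (induction M) auto
    moreover have "n < f n"
    proof -
      have "1 * 2 ^ n \<le> (2 * A * (2 ^ n + 1)) * 2 ^ n"
        using assms(1) by (intro mult_right_mono) (auto simp: Suc_le_eq)
      also have "\<dots> = f n" by (simp only: f_def mult_ac)
      finally show ?thesis using less_exp[of n] by linarith
    qed
    ultimately show False by (meson not_less)
  qed
  then obtain M where M: "f M \<le> n" "n < f (Suc M)" by auto
  \<comment> \<open>The constant 12 is \<open>3 * 2 * 2\<close>: 3 from this estimate, 2 from the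
    width, 2 from passing to \<open>Suc M\<close>.\<close>
  have "(2::nat) * 2 ^ M + 1 \<le> 3 * 2 ^ M" by simp
  then have "f (Suc M) \<le> (3 * 2 ^ M) * (2 * A * (2 * 2 ^ M))"
    unfolding f_def power_Suc by (rule mult_right_mono) simp
  then have "n \<le> 12 * A * (2 ^ M) ^ 2" using M(2) by (simp add: power2_eq_square mult_ac)
  then show thesis using that M(1) by (simp add: f_def)
qed

theorem theorem7p1:
  "\<forall>C::real. C > 0 \<longrightarrow> (\<exists>c::real. c > 0 \<and>
     (\<forall>(n::nat) (\<alpha>::real). n \<ge> 2 \<longrightarrow> \<alpha> \<ge> 1 \<longrightarrow>
       (\<exists>(G :: (nat, nat \<times> nat) pre_digraph) (w :: nat \<times> nat \<Rightarrow> real).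
          digraph G \<and> card (verts G) = n \<and> (\<forall>e \<in> arcs G. w e > 0) \<and>
          (\<forall>H. hopset G H \<and> real (card H) \<le> C * real n \<longrightarrow>
             real (hopbound \<alpha> G w H) \<ge> c * sqrt (real n)))))"
proof (intro allI impI)
  fix C :: real assume "C > 0"
  define A where "A = nat \<lceil>192 * C\<rceil>"
  have A: "A > 0" "192 * C \<le> real A" using \<open>C > 0\<close> by (auto simp: A_def)
  \<comment> \<open>From \<open>n \<le> 12 * A * l ^ 2 \<le> A * (4 * l) ^ 2\<close> follows
    \<open>sqrt n \<le> 4 * l * sqrt A\<close>, and this \<open>c\<close> turns the right side into
    \<open>l / 2\<close>.\<close>
  define c where "c = 1 / (8 * sqrt A)"
  have c: "c > 0" using A by (simp add: c_def)
  have c_le: "c * sqrt (real n) \<le> real l / 2" if "n \<le> 12 * A * l ^ 2" for n l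
  proof -
    have "real n \<le> real (12 * A * l ^ 2)" using that by (rule of_nat_mono)
    also have "\<dots> \<le> A * (4 * real l) ^ 2" by (simp add: power_mult_distrib)
    finally have "sqrt n \<le> sqrt A * (4 * real l)"
      using real_sqrt_le_mono by (fastforce simp: real_sqrt_mult)
    then have "c * sqrt n \<le> c * (sqrt A * (4 * real l))" using c by (intro mult_left_mono) auto
    also have "\<dots> = real l / 2" using A by (simp add: c_def)
    finally show ?thesis .
  qed
  show "\<exists>c::real. c > 0 \<and>
     (\<forall>(n::nat) (\<alpha>::real). n \<ge> 2 \<longrightarrow> \<alpha> \<ge> 1 \<longrightarrow>
       (\<exists>(G :: (nat, nat \<times> nat) pre_digraph) (w :: nat \<times> nat \<Rightarrow> real).
          digraph G \<and> card (verts G) = n \<and> (\<forall>e \<in> arcs G. w e > 0) \<and>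
          (\<forall>H. hopset G H \<and> real (card H) \<le> C * real n \<longrightarrow>
             real (hopbound \<alpha> G w H) \<ge> c * sqrt (real n))))"
  proof (intro exI[of _ c] conjI allI impI c)
    fix n :: nat and \<alpha> :: real assume "n \<ge> 2" and \<alpha>: "\<alpha> \<ge> 1"
    show "\<exists>(G :: (nat, nat \<times> nat) pre_digraph) (w :: nat \<times> nat \<Rightarrow> real).
          digraph G \<and> card (verts G) = n \<and> (\<forall>e \<in> arcs G. w e > 0) \<and>
          (\<forall>H. hopset G H \<and> real (card H) \<le> C * real n \<longrightarrow>
             real (hopbound \<alpha> G w H) \<ge> c * sqrt (real n))"
    proof (cases "4 * A \<le> n")
      case True
      obtain M where M: "(2 ^ M + 1) * (2 * A * 2 ^ M) \<le> n" "n \<le> 12 * A * (2 ^ M) ^ 2"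
        using ex_maximal_layers[OF A(1) True] .
      interpret layered_graph M A n \<alpha>
        using A(1) \<alpha> M(1) by unfold_locales
      have "real (hopbound \<alpha> G weight H) \<ge> c * sqrt (real n)"
        if "hopset G H" "real (card H) \<le> C * real n" for H
        using hopbound_ge[OF A(2) that] c_le[of n L] M(2) \<open>C > 0\<close> by (simp add: L_def)
      then show ?thesis
        using digraph_G weight_pos by (intro exI[of _ G] exI[of _ weight]) auto
    next
      case False
      obtain G :: "(nat, nat \<times> nat) pre_digraph" where G: "digraph G" "card (verts G) = n"
        "\<And>\<alpha> H. \<alpha> \<ge> 1 \<Longrightarrow> hopset G H \<Longrightarrow> hopbound \<alpha> G (\<lambda>_. 1) H \<ge> 1"
        using single_arc_hopbound[OF \<open>n \<ge> 2\<close>] by metis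
      \<comment> \<open>Here \<open>l = 1\<close> is allowed because
        \<open>n < 4 * A \<le> 12 * A\<close>.\<close>
      have "c * sqrt (real n) \<le> 1" using c_le[of n 1] False by simp
      then show ?thesis
        using G \<alpha> by (intro exI[of _ G] exI[of _ "\<lambda>_. 1"]) fastforce
    qed
  qed
qed

end
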